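(* Let $\pi$ be a minimal valid function (for a fixed $f \in \mathbb{R}\setminus\mathbb{Z}$) that is piecewise linear (possibly discontinuous) over $\mathcal{P}$. Assume that $\pi$ is at least one-sided continuous at the origin (that is, continuous from the right at $0$ or continuous from the left at $0$). Let $F$ be a one-dimensional additive face (edge) of $\Delta\mathcal{P}$. Let $\{i,j\}\subset\{1,2,3\}$, $i\neq j$, be such that $p_i(F)$ and $p_j(F)$ are proper (non-degenerate) intervals. Let $E\subseteq F$ be a sub-interval (sub-segment). For $\theta=\pi$ or $\theta=\tilde{\pi}$ with $\tilde\pi\in\tilde{\Pi}^{\pi}(\mathbb{R},\mathbb{Z})$ an effective perturbation function, if $\theta$ is affine on $I=\operatorname{int}(p_i(E))$, then $\theta$ is affine on $I'=\operatorname{int}(p_j(E))$ as well, with the same slope.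
   Context: Fix $f \in \mathbb{R}\setminus\mathbb{Z}$. A function $\pi\colon\mathbb{R}\to\mathbb{R}$ is a minimal valid function if it is $\mathbb{Z}$-periodic, $\pi(0)=0$, $\pi(f)=1$, $\pi(x)\ge 0$ for all $x\in\mathbb{R}$, $\pi(x)+\pi(f-x)=1$ for all $x\in\mathbb{R}$, and $\pi(x)+\pi(y)\ge\pi(x+y)$ for all $x,y\in\mathbb{R}$. Effective perturbations: a function $\tilde\pi\colon\mathbb{R}\to\mathbb{R}$ is an effective perturbation function for a minimal valid function $\pi$, written $\tilde\pi\in\tilde\Pi^{\pi}(\mathbb{R},\mathbb{Z})$, if there exists $\epsilon>0$ such that $\pi+\epsilon\tilde\pi$ and $\pi-\epsilon\tilde\pi$ are both minimal valid functions (for the same $f$). Piecewise linear functions: let $0=x_0<x_1<\dots<x_n=1$ and $B=\{x_i+t : 0\le i\le n-1,\ t\in\mathbb{Z}\}$. Let $\mathcal{P}=\mathcal{P}_B$ be the collection of all singletons $\{x\}$, $x\in B$ (zero-dimensional faces), and all closed intervals $[x_i+t,x_{i+1}+t]$, $0\le i\le n-1$, $t\in\mathbb{Z}$ (one-dimensional faces). A $\mathbb{Z}$-periodic function $\pi$ is piecewise linear over $\mathcal{P}$ if it is affine on the relative interior of each face of $\mathcal{P}$; it may be discontinuous at points of $B$. The complex $\Delta\mathcal{P}$: its faces are the nonempty sets $F=F(I,J,K)=\{(x,y)\in\mathbb{R}\times\mathbb{R} : x\in I,\ y\in J,\ x+y\in K\}$ for $I,J,K\in\mathcal{P}$. Let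 $p_1(x,y)=x$, $p_2(x,y)=y$, $p_3(x,y)=x+y$. A one-dimensional face is a vertical, horizontal or diagonal segment (on which $x$, $y$ or $x+y$, respectively, is constant), so exactly two of its three projections are proper intervals and the third is a singleton. Subadditivity slack: for $\theta\colon\mathbb{R}\to\mathbb{R}$ let $\Delta\theta(x,y)=\theta(x)+\theta(y)-\theta(x+y)$, and for a face $F$ of $\Delta\mathcal{P}$ and $(x,y)\in F$ let $\Delta\theta_F(x,y)=\lim_{(u,v)\to(x,y),\ (u,v)\in\operatorname{rel\,int}(F)}\Delta\theta(u,v)$. Additive faces: for a subadditive function $\pi$ that is piecewise linear over $\mathcal{P}$, a face $F\in\Delta\mathcal{P}$ is additive if $F$ is contained in a face $F'\in\Delta\mathcal{P}$ (possibly $F'=F$) such that $\Delta\pi_{F'}(x,y)=0$ for all $(x,y)\in F$. *)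

theory Defs
  imports "HOL-Analysis.Analysis"
begin

definition slack :: "(real \<Rightarrow> real) \<Rightarrow> real \<times> real \<Rightarrow> real" where
  "slack \<theta> q = \<theta> (fst q) + \<theta> (snd q) - \<theta> (fst q + snd q)"

definition minimal_valid :: "real \<Rightarrow> (real \<Rightarrow> real) \<Rightarrow> bool" where
  "minimal_valid f \<pi> \<longleftrightarrow>
     (\<forall>x (t::int). \<pi> (x + of_int t) = \<pi> x) \<and>
     \<pi> 0 = 0 \<and> \<pi> f = 1 \<and>
     (\<forall>x. \<pi> x \<ge> 0) \<and>
     (\<forall>x. \<pi> x + \<pi> (f - x) = 1) \<and>
     (\<forall>x y. \<pi> x + \<pi> y \<ge> \<pi> (x + y))"

definition effective_perturbation ::
    "real \<Rightarrow> (real \<Rightarrow> real) \<Rightarrow> (real \<Rightarrow> real) \<Rightarrow> bool" where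
  "effective_perturbation f \<pi> \<phi> \<longleftrightarrow>
     (\<exists>\<epsilon>>0. minimal_valid f (\<lambda>x. \<pi> x + \<epsilon> * \<phi> x) \<and>
             minimal_valid f (\<lambda>x. \<pi> x - \<epsilon> * \<phi> x))"

definition affine_with_slope :: "(real \<Rightarrow> real) \<Rightarrow> real \<Rightarrow> real set \<Rightarrow> bool" where
  "affine_with_slope \<theta> c S \<longleftrightarrow> (\<exists>d. \<forall>x\<in>S. \<theta> x = c * x + d)"

definition grid :: "nat \<Rightarrow> (nat \<Rightarrow> real) \<Rightarrow> bool" where
  "grid n xs \<longleftrightarrow> xs 0 = 0 \<and> xs n = 1 \<and> (\<forall>i<n. xs i < xs (Suc i))"

definition breakpoints :: "nat \<Rightarrow> (nat \<Rightarrow> real) \<Rightarrow> real set" where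
  "breakpoints n xs = {xs i + of_int t | (i::nat) (t::int). i < n}"

definition complex_P :: "nat \<Rightarrow> (nat \<Rightarrow> real) \<Rightarrow> real set set" where
  "complex_P n xs =
     {{b} | b. b \<in> breakpoints n xs} \<union>
     {{xs i + of_int t .. xs (Suc i) + of_int t} | (i::nat) (t::int). i < n}"

definition piecewise_linear_over :: "real set set \<Rightarrow> (real \<Rightarrow> real) \<Rightarrow> bool" where
  "piecewise_linear_over P \<pi> \<longleftrightarrow>
     (\<forall>I\<in>P. \<exists>c. affine_with_slope \<pi> c (rel_interior I))"

definition face :: "real set \<Rightarrow> real set \<Rightarrow> real set \<Rightarrow> (real \<times> real) set" where
  "face I J K = {(x, y). x \<in> I \<and> y \<in> J \<and> x + y \<in> K}"

definition Delta_complex :: "real set set \<Rightarrow> (real \<times> real) set set" where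
  "Delta_complex P = {face I J K | I J K. I \<in> P \<and> J \<in> P \<and> K \<in> P \<and> face I J K \<noteq> {}}"

definition proj :: "nat \<Rightarrow> real \<times> real \<Rightarrow> real" where
  "proj i q = (if i = 1 then fst q else if i = 2 then snd q else fst q + snd q)"

definition proper_interval :: "real set \<Rightarrow> bool" where
  "proper_interval S \<longleftrightarrow> (\<exists>a b. a < b \<and> S = {a..b})"

text \<open>
  \<open>has_slack_limit \<theta> F q l\<close> says that the limit of \<open>slack \<theta>\<close> at \<open>q\<close>, taken from within the
  relative interior of \<open>F\<close>, exists and equals \<open>l\<close>. The filter is not
  \<open>at q within rel_interior F\<close>: that one omits \<open>q\<close> itself, hence is trivial when \<open>F\<close> is
  the singleton \<open>{q}\<close>, where the limit is meant to be the value \<open>slack \<theta> q\<close>.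
\<close>
definition has_slack_limit ::
    "(real \<Rightarrow> real) \<Rightarrow> (real \<times> real) set \<Rightarrow> real \<times> real \<Rightarrow> real \<Rightarrow> bool" where
  "has_slack_limit \<theta> F q l \<longleftrightarrow>
     (slack \<theta> \<longlongrightarrow> l) (inf (nhds q) (principal (rel_interior F)))"

definition additive_face :: "real set set \<Rightarrow> (real \<Rightarrow> real) \<Rightarrow> (real \<times> real) set \<Rightarrow> bool" where
  "additive_face P \<pi> F \<longleftrightarrow>
     F \<in> Delta_complex P \<and>
     (\<exists>F'\<in>Delta_complex P. F \<subseteq> F' \<and> (\<forall>q\<in>F. has_slack_limit \<pi> F' q 0))"

end

theory Submission
  imports Defs
begin

text \<open>
  Write $(q_1, q_2, q_3)$ for the projections $(x, y, x + y)$ of a point $q = (x, y)$, so that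
  the slack of \<open>\<theta>\<close> is the signed sum $\theta(q_1) + \theta(q_2) - \theta(q_3)$. On an edge one of the
  three projections, the $k$-th, is constant. If the slack of \<open>\<theta>\<close> vanished at two points
  \<open>q\<close> and \<open>q'\<close> of the edge, subtracting the two equations would cancel the
  $k$-th terms and give
  $$\pm(\theta(q_i) - \theta(q'_i)) \pm (\theta(q_j) - \theta(q'_j)) = 0.$$
  The identity function has slack zero, so the increments $q_i - q'_i$ and $q_j - q'_j$ satisfy the
  same relation with the same signs. Hence a slope of \<open>\<theta>\<close> between $q_i$ and $q'_i$ is
  also its slope between $q_j$ and $q'_j$.

  Additivity of the edge \<open>F\<close>, however, only gives slack zero in the limit from the
  relative interior of some face \<open>F'\<close> that contains \<open>F\<close>, and \<open>\<theta>\<close> may jump at the value of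
  the constant projection. The remedy is to move \<open>q\<close> and \<open>q'\<close> into that relative interior
  by the same vector $t w$ and let $t$ tend to zero from the right
  (\<open>rel_interior_parallel_approach\<close>). The $k$-th projections of the
  translated points still agree, so their terms cancel before the limit is taken, whatever
  \<open>\<theta>\<close> does there (\<open>increments_cancel_along_additive_edge\<close>). Only continuity of \<open>\<theta>\<close> at
  the $i$-th and $j$-th projections is used, and these lie inside one-dimensional cells of the
  complex, where \<open>\<pi>\<close> is affine.

  Continuity of a perturbation there is where one-sided continuity of \<open>\<pi>\<close> at the origin enters.
  Nonnegativity and subadditivity of $\pi \pm \epsilon\theta$ bound both \<open>\<theta>\<close> and its slack by
  multiples of \<open>\<pi>\<close> and its slack. These bounds make $\theta(x + h) - \theta(x)$ small as soon as
  $\pi(h)$ and $\pi(x + h) - \pi(x)$ are small (\<open>controlled_continuous\<close>). The same bounds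
  transport the vanishing slack limits from \<open>\<pi>\<close> to \<open>\<theta>\<close>.
\<close>

section \<open>The three projections\<close>

text \<open>
  The coefficients of the linear relation $q_1 + q_2 - q_3 = 0$. With them the vertical,
  horizontal and diagonal edges are treated by one argument.
\<close>
definition proj_sign :: "nat \<Rightarrow> real" where
  "proj_sign k = (if k = 3 then - 1 else 1)"

lemma proj_sign_cases: "proj_sign k = 1 \<or> proj_sign k = - 1"
  by (simp add: proj_sign_def)

lemma slack_eq_signed_sum:
  assumes "{i, j, k} = {1, 2, 3}"
  shows "slack \<theta> q = proj_sign i * \<theta> (proj i q) + proj_sign j * \<theta> (proj j q)
           + proj_sign k * \<theta> (proj k q)"
proof -
  have range: "i = 1 \<or> i = 2 \<or> i = 3" "j = 1 \<or> j = 2 \<or> j = 3" "k = 1 \<or> k = 2 \<or> k = 3"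
    using assms by blast+
  have cover: "1 \<in> {i, j, k}" "2 \<in> {i, j, k}" "3 \<in> {i, j, k}"
    unfolding assms by simp_all
  show ?thesis
    using range
    by (elim disjE) (use cover in \<open>simp_all add: slack_def proj_def proj_sign_def\<close>)
qed

lemma proj_signed_sum_zero:
  assumes "{i, j, k} = {1, 2, 3}"
  shows "proj_sign i * proj i q + proj_sign j * proj j q + proj_sign k * proj k q = 0"
  using slack_eq_signed_sum[OF assms, of "\<lambda>x. x" q] by (simp add: slack_def)

lemma linear_proj: "linear (proj k)"
  by (rule linearI) (auto simp: proj_def algebra_simps)

lemma two_projs_determine_point:
  assumes "{i, j, k} = {1, 2, 3}" "proj j p = proj j q" "proj k p = proj k q"
  shows "p = q"
proof -
  have "proj_sign i * proj i p = proj_sign i * proj i q"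
    using proj_signed_sum_zero[OF assms(1), of p] proj_signed_sum_zero[OF assms(1), of q]
    unfolding assms(2,3) by linarith
  hence i: "proj i p = proj i q"
    using proj_sign_cases[of i] by auto
  have "1 \<in> {i,j,k}" "2 \<in> {i,j,k}" using assms(1) by simp_all
  hence "proj 1 p = proj 1 q" "proj 2 p = proj 2 q"
    using i assms(2,3) by auto
  thus ?thesis by (simp add: proj_def prod_eq_iff)
qed

lemma face_eq_proj: "face I J K = {q. proj 1 q \<in> I \<and> proj 2 q \<in> J \<and> proj 3 q \<in> K}"
  by (auto simp: face_def proj_def)

section \<open>Edges of the complex\<close>

lemma complex_P_convex:
  assumes "I \<in> complex_P n xs" shows "convex I"
  using assms by (auto simp: complex_P_def)

lemma Delta_complex_proj_cell:
  assumes "F \<in> Delta_complex (complex_P n xs)"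
  obtains C where "\<And>k. k \<in> {1,2,3} \<Longrightarrow> C k \<in> complex_P n xs"
    and "F = {q. \<forall>k\<in>{1,2,3}. proj k q \<in> C k}"
proof -
  obtain I J K where IJK: "I \<in> complex_P n xs" "J \<in> complex_P n xs" "K \<in> complex_P n xs"
    "F = face I J K"
    using assms by (auto simp: Delta_complex_def)
  define C where "C = (\<lambda>k::nat. if k = 1 then I else if k = 2 then J else K)"
  show thesis
  proof (rule that[of C])
    show "C k \<in> complex_P n xs" if "k \<in> {1,2,3}" for k
      using that IJK by (auto simp: C_def)
    show "F = {q. \<forall>k\<in>{1,2,3}. proj k q \<in> C k}"
      unfolding IJK(4) face_eq_proj by (simp add: C_def)
  qed
qed

lemma Delta_complex_convex:
  assumes "F \<in> Delta_complex (complex_P n xs)"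
  shows "convex F"
proof -
  obtain C where C: "\<And>k. k \<in> {1,2,3} \<Longrightarrow> C k \<in> complex_P n xs"
    and F: "F = {q. \<forall>k\<in>{1,2,3}. proj k q \<in> C k}"
    using Delta_complex_proj_cell[OF assms] by blast
  have "F = (\<Inter>k\<in>{1,2,3}. proj k -` C k)"
    unfolding F by auto
  also have "convex \<dots>"
    using C by (intro convex_INT convex_linear_vimage linear_proj complex_P_convex)
  finally show ?thesis .
qed

text \<open>
  If all three projections varied on the edge, the line spanned by it would be neither
  vertical nor horizontal nor diagonal. The midpoint of two distinct points of the edge would then have
  every projection in the interior of its cell, so the face would contain a disc and be
  two-dimensional.
\<close>
lemma third_proj_constant_on_edge:
  assumes F: "F \<in> Delta_complex (complex_P n xs)" and dim: "aff_dim F = 1"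
    and ijk: "{i, j, k} = {1, 2, 3}"
    and i: "proper_interval (proj i ` F)" and j: "proper_interval (proj j ` F)"
    and pq: "p \<in> F" "q \<in> F"
  shows "proj k p = proj k q"
proof (rule ccontr)
  assume neq: "proj k p \<noteq> proj k q"
  obtain C where C: "\<And>l. l \<in> {1,2,3} \<Longrightarrow> C l \<in> complex_P n xs"
    and FC: "F = {q. \<forall>l\<in>{1,2,3}. proj l q \<in> C l}"
    using Delta_complex_proj_cell[OF F] by blast
  have "collinear F"
    using dim by (simp add: collinear_aff_dim)
  then obtain u where u: "\<And>x y. x \<in> F \<Longrightarrow> y \<in> F \<Longrightarrow> \<exists>c. x - y = c *\<^sub>R u"
    unfolding collinear_def by blast
  have u_nz: "proj l u \<noteq> 0" if xy: "x \<in> F" "y \<in> F" "proj l x \<noteq> proj l y" for x y l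
  proof
    assume 0: "proj l u = 0"
    obtain c where "x - y = c *\<^sub>R u" using u[OF xy(1,2)] by blast
    hence "proj l x - proj l y = c * proj l u"
      by (metis linear_diff linear_proj linear_scale real_scaleR_def)
    thus False using 0 xy(3) by simp
  qed
  have two: "\<exists>x\<in>F. \<exists>y\<in>F. proj l x \<noteq> proj l y" if "proper_interval (proj l ` F)" for l
  proof -
    from that obtain a b where ab: "a < b" "proj l ` F = {a..b}"
      unfolding proper_interval_def by blast
    then have "a \<in> proj l ` F" "b \<in> proj l ` F" by auto
    thus ?thesis using ab(1) by (metis imageE less_irrefl)
  qed
  have nz: "proj l u \<noteq> 0" if "l \<in> {1,2,3}" for l
  proof -
    have "l = i \<or> l = j \<or> l = k" using that ijk by blast
    thus ?thesis using two[OF i] two[OF j] u_nz pq neq by blast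
  qed
  obtain c where c: "p - q = c *\<^sub>R u" using u pq by blast
  have c0: "c \<noteq> 0" using c neq by auto
  define m where "m = midpoint p q"
  have m_in: "proj l m \<in> interior (C l)" if l: "l \<in> {1,2,3}" for l
  proof -
    have pl: "proj l p \<in> C l" "proj l q \<in> C l" using pq l FC by blast+
    have "proj l p - proj l q = c * proj l u"
      using c by (metis linear_diff linear_proj linear_scale real_scaleR_def)
    hence ne: "proj l p \<noteq> proj l q" using c0 nz[OF l] by auto
    have "proj l m = midpoint (proj l p) (proj l q)"
      unfolding m_def midpoint_def by (simp add: linear_add[OF linear_proj] linear_scale[OF linear_proj])
    hence "proj l m \<in> {min (proj l p) (proj l q) <..< max (proj l p) (proj l q)}"
      using ne by (auto simp: midpoint_def min_def max_def)
    moreover have "{min (proj l p) (proj l q) <..< max (proj l p) (proj l q)} \<subseteq> C l"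
    proof
      fix x assume x: "x \<in> {min (proj l p) (proj l q) <..< max (proj l p) (proj l q)}"
      have "closed_segment (proj l p) (proj l q) \<subseteq> C l"
        using closed_segment_subset[OF pl complex_P_convex[OF C[OF l]]] .
      thus "x \<in> C l" using x by (auto simp: closed_segment_eq_real_ivl min_def max_def split: if_splits)
    qed
    ultimately show ?thesis using interiorI open_greaterThanLessThan by blast
  qed
  have "open (\<Inter>l\<in>{1,2,3}. proj l -` interior (C l))"
    by (intro open_INT ballI open_vimage open_interior linear_continuous_on
        linear_conv_bounded_linear[THEN iffD1] linear_proj) auto
  moreover have "m \<in> (\<Inter>l\<in>{1,2,3}. proj l -` interior (C l))" using m_in by blast
  moreover have "(\<Inter>l\<in>{1,2,3}. proj l -` interior (C l)) \<subseteq> F"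
    unfolding FC using interior_subset by fast
  ultimately have "interior F \<noteq> {}" using interiorI by blast
  hence "aff_dim F = 2" using aff_dim_nonempty_interior[of F] by simp
  thus False using dim by simp
qed

section \<open>Continuity of functions controlled by the slack\<close>

text \<open>
  A minimal valid \<open>\<pi>\<close> itself and its effective perturbations have this in common, which allows
  treating them together.
\<close>
definition controlled_by :: "real \<Rightarrow> (real \<Rightarrow> real) \<Rightarrow> (real \<Rightarrow> real) \<Rightarrow> bool" where
  "controlled_by C \<pi> \<theta> \<longleftrightarrow> (\<forall>q. \<bar>slack \<theta> q\<bar> \<le> C * slack \<pi> q) \<and> (\<forall>x. \<bar>\<theta> x\<bar> \<le> C * \<pi> x)"

lemma minimal_valid_nonneg:
  assumes "minimal_valid f \<pi>"
  shows "\<pi> x \<ge> 0" "slack \<pi> q \<ge> 0"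
  using assms by (simp_all add: minimal_valid_def slack_def)

lemma minimal_valid_controlled_by_self:
  assumes "minimal_valid f \<pi>"
  shows "controlled_by 1 \<pi> \<pi>"
  using minimal_valid_nonneg[OF assms] by (simp add: controlled_by_def)

lemma effective_perturbation_controlled:
  assumes "effective_perturbation f \<pi> \<theta>"
  obtains C where "controlled_by C \<pi> \<theta>"
proof -
  obtain \<epsilon> where e: "\<epsilon> > 0" "minimal_valid f (\<lambda>x. \<pi> x + \<epsilon> * \<theta> x)"
      "minimal_valid f (\<lambda>x. \<pi> x - \<epsilon> * \<theta> x)"
    using assms unfolding effective_perturbation_def by blast
  have scale: "\<bar>s\<bar> \<le> (1 / \<epsilon>) * t" if "t + \<epsilon> * s \<ge> 0" "t - \<epsilon> * s \<ge> 0" for s t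
  proof -
    have "\<epsilon> * \<bar>s\<bar> \<le> t" using that e(1) by (auto simp: abs_if)
    thus ?thesis using e(1) by (simp add: field_simps)
  qed
  have "controlled_by (1 / \<epsilon>) \<pi> \<theta>"
    unfolding controlled_by_def
  proof (intro conjI allI scale)
    fix q
    show "0 \<le> slack \<pi> q + \<epsilon> * slack \<theta> q" "0 \<le> slack \<pi> q - \<epsilon> * slack \<theta> q"
      using minimal_valid_nonneg(2)[OF e(2), of q] minimal_valid_nonneg(2)[OF e(3), of q]
      by (simp_all add: slack_def algebra_simps)
  qed (use minimal_valid_nonneg(1)[OF e(2)] minimal_valid_nonneg(1)[OF e(3)] in auto)
  thus thesis by (rule that)
qed

text \<open>
  The increment is $\theta(h)$ minus the slack at $(x, h)$, and both are bounded in terms of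
  \<open>\<pi>\<close>.
\<close>
lemma controlled_increment_bound:
  assumes "controlled_by C \<pi> \<theta>"
  shows "\<bar>\<theta> (x + h) - \<theta> x\<bar> \<le> C * (\<pi> x - \<pi> (x + h) + 2 * \<pi> h)"
proof -
  have "\<bar>slack \<theta> (x, h)\<bar> \<le> C * slack \<pi> (x, h)" "\<bar>\<theta> h\<bar> \<le> C * \<pi> h"
    using assms by (auto simp: controlled_by_def)
  thus ?thesis by (simp add: slack_def algebra_simps)
qed

text \<open>
  The increment bound is used at $(x, h)$ and at $(x - h, h)$. In this way small $h$ of a single
  sign control \<open>\<theta>\<close> on both sides of \<open>x\<close>, and one-sided continuity of \<open>\<pi>\<close> at
  the origin suffices for two-sided continuity of \<open>\<theta>\<close>.
\<close>
lemma controlled_continuous: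
  assumes ctl: "controlled_by C \<pi> \<theta>" and zero: "\<pi> 0 = 0"
    and side: "continuous (at_right 0) \<pi> \<or> continuous (at_left 0) \<pi>"
    and cont: "isCont \<pi> x"
  shows "isCont \<theta> x"
proof -
  \<comment> \<open>\<open>G\<close> stands for the one-sided filter at 0 along which \<open>\<pi>\<close> is continuous.\<close>
  have both: "((\<lambda>h. \<theta> (x + h)) \<longlongrightarrow> \<theta> x) G \<and> ((\<lambda>h. \<theta> (x - h)) \<longlongrightarrow> \<theta> x) G"
    if G: "G \<le> at 0" "(\<pi> \<longlongrightarrow> 0) G" for G
  proof -
    have id: "((\<lambda>h. h) \<longlongrightarrow> 0) G"
      using G(1) tendsto_mono tendsto_ident_at by blast
    have *: "((\<lambda>h. \<pi> (x + h)) \<longlongrightarrow> \<pi> x) G" "((\<lambda>h. \<pi> (x - h)) \<longlongrightarrow> \<pi> x) G"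
      using isCont_tendsto_compose[OF cont, of "\<lambda>h. x + h" G] isCont_tendsto_compose[OF cont, of "\<lambda>h. x - h" G]
        tendsto_add[OF tendsto_const id, of x] tendsto_diff[OF tendsto_const id, of x] by simp_all
    have "((\<lambda>h. \<theta> (x + h) - \<theta> x) \<longlongrightarrow> 0) G"
    proof (rule Lim_null_comparison)
      show "\<forall>\<^sub>F h in G. norm (\<theta> (x + h) - \<theta> x) \<le> C * (\<pi> x - \<pi> (x + h) + 2 * \<pi> h)"
        using controlled_increment_bound[OF ctl] by simp
      show "((\<lambda>h. C * (\<pi> x - \<pi> (x + h) + 2 * \<pi> h)) \<longlongrightarrow> 0) G"
        by (rule tendsto_eq_intros * G | simp)+
    qed
    moreover have "((\<lambda>h. \<theta> (x - h) - \<theta> x) \<longlongrightarrow> 0) G"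
    proof (rule Lim_null_comparison)
      show "\<forall>\<^sub>F h in G. norm (\<theta> (x - h) - \<theta> x) \<le> C * (\<pi> (x - h) - \<pi> x + 2 * \<pi> h)"
        using controlled_increment_bound[OF ctl, of "x - h" h for h] by (simp add: abs_minus_commute)
      show "((\<lambda>h. C * (\<pi> (x - h) - \<pi> x + 2 * \<pi> h)) \<longlongrightarrow> 0) G"
        by (rule tendsto_eq_intros * G | simp)+
    qed
    ultimately show ?thesis by (simp add: LIM_zero_iff)
  qed
  have "((\<lambda>h. \<theta> (x + h)) \<longlongrightarrow> \<theta> x) (at_right 0) \<and> ((\<lambda>h. \<theta> (x + h)) \<longlongrightarrow> \<theta> x) (at_left 0)"
    using side
  proof
    assume "continuous (at_right 0) \<pi>"
    hence "((\<lambda>h. \<theta> (x + h)) \<longlongrightarrow> \<theta> x) (at_right 0) \<and> ((\<lambda>h. \<theta> (x - h)) \<longlongrightarrow> \<theta> x) (at_right 0)"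
      by (intro both at_le) (simp_all add: continuous_within zero)
    thus ?thesis by (simp add: filterlim_at_left_to_right)
  next
    assume "continuous (at_left 0) \<pi>"
    hence "((\<lambda>h. \<theta> (x + h)) \<longlongrightarrow> \<theta> x) (at_left 0) \<and> ((\<lambda>h. \<theta> (x - h)) \<longlongrightarrow> \<theta> x) (at_left 0)"
      by (intro both at_le) (simp_all add: continuous_within zero)
    thus ?thesis by (simp add: filterlim_at_left_to_right)
  qed
  hence "((\<lambda>h. \<theta> (x + h)) \<longlongrightarrow> \<theta> x) (at 0)"
    by (simp add: filterlim_split_at)
  thus ?thesis by (simp add: isCont_iff)
qed

lemma piecewise_linear_isCont_interior:
  assumes pl: "piecewise_linear_over (complex_P n xs) \<pi>"
    and I: "I \<in> complex_P n xs" and x: "x \<in> interior I"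
  shows "isCont \<pi> x"
proof -
  obtain c d where "\<And>y. y \<in> rel_interior I \<Longrightarrow> \<pi> y = c * y + d"
    using pl I unfolding piecewise_linear_over_def affine_with_slope_def by blast
  hence eq: "\<And>y. y \<in> interior I \<Longrightarrow> \<pi> y = c * y + d"
    using interior_subset_rel_interior by blast
  have "continuous_on (interior I) \<pi>"
    by (subst continuous_on_cong[OF refl eq]) (auto intro!: continuous_intros)
  thus ?thesis using x by (simp add: continuous_on_eq_continuous_at)
qed

section \<open>Transfer along an additive edge\<close>

text \<open>
  Both \<open>q\<close> and a point \<open>p - e *\<^sub>R (p - q)\<close> of the open segment from \<open>p\<close> to \<open>q\<close> enter the relative
  interior along the same direction \<open>r - q\<close>. For the second point the reason is that its translate
  lies on the segment from \<open>p\<close> to a point of the relative interior between \<open>q\<close> and \<open>r\<close>.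
\<close>
lemma rel_interior_parallel_approach:
  fixes p q r :: "'a::euclidean_space"
  assumes S: "convex S" "p \<in> S" "q \<in> S" "r \<in> rel_interior S"
    and e: "0 < e" "e < 1"
  shows "\<forall>\<^sub>F t in at_right 0. q + t *\<^sub>R (r - q) \<in> rel_interior S
           \<and> (p - e *\<^sub>R (p - q)) + t *\<^sub>R (r - q) \<in> rel_interior S"
proof -
  have toward: "q + t *\<^sub>R (r - q) \<in> rel_interior S" if "0 < t" "t \<le> 1" for t
    using rel_interior_convex_shrink[OF S(1,4,3) that] by (simp add: algebra_simps)
  have "q + t *\<^sub>R (r - q) \<in> rel_interior S
           \<and> (p - e *\<^sub>R (p - q)) + t *\<^sub>R (r - q) \<in> rel_interior S"
    if t: "0 < t" "t < e" for t
  proof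
    show "q + t *\<^sub>R (r - q) \<in> rel_interior S"
      using toward t e by simp
    \<comment> \<open>Contraction towards \<open>p\<close> scales a displacement of \<open>q\<close> by \<open>e\<close>, hence the step \<open>t / e\<close>.\<close>
    have "p - e *\<^sub>R (p - (q + (t / e) *\<^sub>R (r - q))) \<in> rel_interior S"
      using rel_interior_convex_shrink[OF S(1) toward S(2)] t e by simp
    also have "p - e *\<^sub>R (p - (q + (t / e) *\<^sub>R (r - q))) = (p - e *\<^sub>R (p - q)) + t *\<^sub>R (r - q)"
      using e by (simp add: algebra_simps)
    finally show "(p - e *\<^sub>R (p - q)) + t *\<^sub>R (r - q) \<in> rel_interior S" .
  qed
  thus ?thesis
    unfolding eventually_at_right_field using e(1) by blast
qed

text \<open>
  The $k$-th terms of the two slacks are equal for every translation parameter, since the $k$-th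
  projections of the translated points coincide. They therefore disappear from the difference of the
  slacks without any assumption on \<open>\<theta>\<close> at the value \<open>proj k q\<close>. The point \<open>p\<close> lies beyond
  \<open>q'\<close> as seen from \<open>q\<close>; it is what makes the common direction available.
\<close>
lemma increments_cancel_along_additive_edge:
  assumes ijk: "{i, j, k} = {1, 2, 3}"
    and F': "convex F'" "p \<in> F'" "q \<in> F'"
    and q': "q' = p - e *\<^sub>R (p - q)" "0 < e" "e < 1"
    and lim: "has_slack_limit \<theta> F' q 0" "has_slack_limit \<theta> F' q' 0"
    and k: "proj k q = proj k q'"
    and cont: "isCont \<theta> (proj i q)" "isCont \<theta> (proj j q)"
              "isCont \<theta> (proj i q')" "isCont \<theta> (proj j q')"
  shows "proj_sign i * (\<theta> (proj i q) - \<theta> (proj i q'))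
           + proj_sign j * (\<theta> (proj j q) - \<theta> (proj j q')) = 0"
proof -
  obtain r where r: "r \<in> rel_interior F'"
    using F' rel_interior_eq_empty by blast
  define w where "w = r - q"
  have ev: "\<forall>\<^sub>F t in at_right 0. q + t *\<^sub>R w \<in> rel_interior F' \<and> q' + t *\<^sub>R w \<in> rel_interior F'"
    using rel_interior_parallel_approach[OF F' r q'(2,3)] unfolding w_def q'(1) .
  have path: "((\<lambda>t. s + t *\<^sub>R w) \<longlongrightarrow> s) (at_right 0)" for s
    by (rule tendsto_eq_intros | simp)+
  have slack0: "((\<lambda>t. slack \<theta> (s + t *\<^sub>R w)) \<longlongrightarrow> 0) (at_right 0)"
    if "has_slack_limit \<theta> F' s 0" "\<forall>\<^sub>F t in at_right 0. s + t *\<^sub>R w \<in> rel_interior F'" for s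
  proof -
    have "filterlim (\<lambda>t. s + t *\<^sub>R w) (inf (nhds s) (principal (rel_interior F'))) (at_right 0)"
      using path that(2) by (simp add: filterlim_inf filterlim_principal)
    thus ?thesis
      using filterlim_compose that(1) unfolding has_slack_limit_def by blast
  qed
  have proj_path: "((\<lambda>t. \<theta> (proj l (s + t *\<^sub>R w))) \<longlongrightarrow> \<theta> (proj l s)) (at_right 0)"
    if "isCont \<theta> (proj l s)" for l s
  proof (rule isCont_tendsto_compose[OF that])
    have "((\<lambda>t. proj l s + t * proj l w) \<longlongrightarrow> proj l s) (at_right 0)"
      by (rule tendsto_eq_intros | simp)+
    thus "((\<lambda>t. proj l (s + t *\<^sub>R w)) \<longlongrightarrow> proj l s) (at_right 0)"
      by (simp add: linear_add[OF linear_proj] linear_scale[OF linear_proj])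
  qed
  let ?D = "\<lambda>l t. \<theta> (proj l (q + t *\<^sub>R w)) - \<theta> (proj l (q' + t *\<^sub>R w))"
  have "((\<lambda>t. slack \<theta> (q + t *\<^sub>R w) - slack \<theta> (q' + t *\<^sub>R w)) \<longlongrightarrow> 0 - 0) (at_right 0)"
    using ev by (intro tendsto_diff slack0 lim) (auto elim: eventually_mono)
  moreover have "slack \<theta> (q + t *\<^sub>R w) - slack \<theta> (q' + t *\<^sub>R w)
                   = proj_sign i * ?D i t + proj_sign j * ?D j t" for t
    unfolding slack_eq_signed_sum[OF ijk]
    by (simp add: linear_add[OF linear_proj] linear_scale[OF linear_proj] k algebra_simps)
  ultimately have "((\<lambda>t. proj_sign i * ?D i t + proj_sign j * ?D j t) \<longlongrightarrow> 0) (at_right 0)"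
    by simp
  moreover have "((\<lambda>t. proj_sign i * ?D i t + proj_sign j * ?D j t) \<longlongrightarrow>
       proj_sign i * (\<theta> (proj i q) - \<theta> (proj i q')) + proj_sign j * (\<theta> (proj j q) - \<theta> (proj j q')))
       (at_right 0)"
    by (intro tendsto_intros proj_path cont)
  ultimately show ?thesis
    using tendsto_unique trivial_limit_at_right_real by blast
qed

lemma controlled_slack_limit_zero:
  assumes "controlled_by C \<pi> \<theta>" "has_slack_limit \<pi> F q 0"
  shows "has_slack_limit \<theta> F q 0"
  unfolding has_slack_limit_def
proof (rule Lim_null_comparison)
  show "\<forall>\<^sub>F p in inf (nhds q) (principal (rel_interior F)). norm (slack \<theta> p) \<le> C * slack \<pi> p"
    using assms(1) unfolding controlled_by_def by (intro always_eventually) simp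
  show "((\<lambda>p. C * slack \<pi> p) \<longlongrightarrow> 0) (inf (nhds q) (principal (rel_interior F)))"
    using assms(2) unfolding has_slack_limit_def by (rule tendsto_mult_right_zero)
qed

text \<open>
  Where the $k$-th projection is constant, the $i$-th projection is the $j$-th one followed by an
  affine bijection of the line, which maps open sets to open sets.
\<close>
lemma interior_proj_transfer:
  assumes ijk: "{i, j, k} = {1, 2, 3}"
    and const: "\<And>p. p \<in> E \<Longrightarrow> proj k p = \<kappa>"
    and q: "q \<in> E" "proj j q \<in> interior (proj j ` E)"
  shows "proj i q \<in> interior (proj i ` E)"
proof -
  define a b where "a = - proj_sign j / proj_sign i" and "b = - proj_sign k * \<kappa> / proj_sign i"
  have nz: "proj_sign l \<noteq> 0" for l by (simp add: proj_sign_def)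
  have eq: "proj i p = a * proj j p + b" if "p \<in> E" for p
    using proj_signed_sum_zero[OF ijk, of p] const[OF that] nz[of i]
    by (simp add: a_def b_def field_simps)
  let ?g = "\<lambda>z. a *\<^sub>R z + b"
  have "open (?g ` interior (proj j ` E))"
  proof -
    have "open ((\<lambda>z. b + a *\<^sub>R z) ` interior (proj j ` E))"
      by (rule open_affinity) (simp_all add: a_def nz)
    thus ?thesis by (simp add: add.commute)
  qed
  moreover have "?g ` interior (proj j ` E) \<subseteq> proj i ` E"
  proof
    fix y assume "y \<in> ?g ` interior (proj j ` E)"
    then obtain p where "p \<in> E" "y = a * proj j p + b"
      using interior_subset by fastforce
    thus "y \<in> proj i ` E" by (simp add: eq[symmetric])
  qed
  moreover have "proj i q \<in> ?g ` interior (proj j ` E)"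
    using q eq by auto
  ultimately show ?thesis using interiorI by blast
qed

lemma open_segment_beyond:
  fixes z z' :: real
  assumes "z' \<in> interior A" "z \<noteq> z'"
  obtains y e where "y \<in> A" "0 < e" "e < 1" "z' = y - e * (y - z)"
proof -
  obtain \<delta> where d: "\<delta> > 0" "ball z' \<delta> \<subseteq> A"
    using assms(1) mem_interior by blast
  \<comment> \<open>With this factor \<open>z' + s * (z' - z)\<close> is at distance \<open>\<delta> / 2\<close> from \<open>z'\<close>.\<close>
  define s where "s = \<delta> / (2 * \<bar>z' - z\<bar>)"
  have s: "s > 0" using d assms by (simp add: s_def)
  show thesis
  proof (rule that[of "z' + s * (z' - z)" "s / (1 + s)"])
    have "\<bar>s * (z' - z)\<bar> = \<delta> / 2"
      using d(1) assms(2) by (simp add: s_def abs_mult)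
    hence "z' + s * (z' - z) \<in> ball z' \<delta>"
      using d(1) by (simp add: dist_real_def)
    thus "z' + s * (z' - z) \<in> A" using d(2) by blast
    show "z' = z' + s * (z' - z) - s / (1 + s) * (z' + s * (z' - z) - z)"
    proof -
      have "z' + s * (z' - z) - z = (1 + s) * (z' - z)" by (simp add: algebra_simps)
      thus ?thesis using s by simp
    qed
  qed (use s in auto)
qed

theorem theorem6p3:
  fixes f :: real and \<pi> \<theta> :: "real \<Rightarrow> real"
    and n :: nat and xs :: "nat \<Rightarrow> real"
    and F E :: "(real \<times> real) set" and i j :: nat
  assumes "f \<notin> \<int>"
    and "grid n xs"
    and "minimal_valid f \<pi>"
    and "piecewise_linear_over (complex_P n xs) \<pi>"
    and "continuous (at_right 0) \<pi> \<or> continuous (at_left 0) \<pi>"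
    and "additive_face (complex_P n xs) \<pi> F"
    and "aff_dim F = 1"
    and "i \<in> {1, 2, 3}" and "j \<in> {1, 2, 3}" and "i \<noteq> j"
    and "proper_interval (proj i ` F)" and "proper_interval (proj j ` F)"
    and "E \<subseteq> F" and "convex E"
    and "\<theta> = \<pi> \<or> effective_perturbation f \<pi> \<theta>"
  shows "\<forall>c. affine_with_slope \<theta> c (interior (proj i ` E)) \<longrightarrow>
             affine_with_slope \<theta> c (interior (proj j ` E))"
proof (intro allI impI)
  fix c assume aff: "affine_with_slope \<theta> c (interior (proj i ` E))"
  obtain k where ijk: "{i, j, k} = {1, 2, 3}"
  proof
    \<comment> \<open>The three indices add up to 6.\<close>
    show "{i, j, 6 - i - j} = {1, 2, 3}"
      using assms(8-10) by auto
  qed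
  have jik: "{j, i, k} = {1, 2, 3}" using ijk by blast
  have F: "F \<in> Delta_complex (complex_P n xs)"
    using assms(6) by (simp add: additive_face_def)
  obtain F' where F': "F' \<in> Delta_complex (complex_P n xs)" "F \<subseteq> F'"
    and lim: "\<And>q. q \<in> F \<Longrightarrow> has_slack_limit \<pi> F' q 0"
    using assms(6) by (auto simp: additive_face_def)
  obtain C where ctl: "controlled_by C \<pi> \<theta>"
    using assms(15) minimal_valid_controlled_by_self[OF assms(3)] effective_perturbation_controlled
    by blast
  have zero: "\<pi> 0 = 0" using assms(3) by (simp add: minimal_valid_def)
  have const: "proj k p = proj k q" if "p \<in> E" "q \<in> E" for p q
    using third_proj_constant_on_edge[OF F assms(7) ijk assms(11,12)] that assms(13) by blast
  have cont: "isCont \<theta> x" if x: "x \<in> interior (proj l ` E)" and l: "l \<in> {1,2,3}" for x l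
  proof -
    obtain G where G: "\<And>l. l \<in> {1,2,3} \<Longrightarrow> G l \<in> complex_P n xs"
      and FG: "F = {q. \<forall>l\<in>{1,2,3}. proj l q \<in> G l}"
      using Delta_complex_proj_cell[OF F] by blast
    have "proj l ` E \<subseteq> G l" using assms(13) FG l by blast
    hence "x \<in> interior (G l)" using x interior_mono by blast
    thus ?thesis
      by (intro controlled_continuous[OF ctl zero assms(5)]
          piecewise_linear_isCont_interior[OF assms(4) G[OF l]])
  qed
  have diff: "\<theta> z - \<theta> z' = c * (z - z')"
    if z: "z \<in> interior (proj j ` E)" "z' \<in> interior (proj j ` E)" for z z'
  proof (cases "z = z'")
    case False
    obtain q q' where q: "q \<in> E" "proj j q = z" "q' \<in> E" "proj j q' = z'"
      using z interior_subset by blast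
    \<comment> \<open>A point of \<open>E\<close> beyond \<open>q'\<close>, needed to approach \<open>q\<close> and \<open>q'\<close> in parallel.\<close>
    obtain y e where y: "y \<in> proj j ` E" "0 < e" "e < 1" "z' = y - e * (y - z)"
      using open_segment_beyond[OF z(2) False] by blast
    obtain p where p: "p \<in> E" "proj j p = y" using y(1) by blast
    have lin: "proj l (p - e *\<^sub>R (p - q)) = proj l p - e * (proj l p - proj l q)" for l
      by (simp add: linear_diff[OF linear_proj] linear_scale[OF linear_proj])
    have q': "q' = p - e *\<^sub>R (p - q)"
    proof (rule two_projs_determine_point[OF ijk])
      show "proj j q' = proj j (p - e *\<^sub>R (p - q))"
        using q p y by (simp add: lin)
      show "proj k q' = proj k (p - e *\<^sub>R (p - q))"
        using const[OF q(3) q(1)] const[OF p(1) q(1)] by (simp add: lin)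
    qed
    have int_i: "proj i q \<in> interior (proj i ` E)" "proj i q' \<in> interior (proj i ` E)"
      using interior_proj_transfer[OF ijk const[OF _ q(1)]] q z by auto
    have "proj_sign i * (\<theta> (proj i q) - \<theta> (proj i q'))
           + proj_sign j * (\<theta> (proj j q) - \<theta> (proj j q')) = 0"
    proof (rule increments_cancel_along_additive_edge[OF ijk Delta_complex_convex[OF F'(1)] _ _ q' y(2,3)])
      show "p \<in> F'" "q \<in> F'" using p q F'(2) assms(13) by blast+
      show "has_slack_limit \<theta> F' q 0" "has_slack_limit \<theta> F' q' 0"
        using controlled_slack_limit_zero[OF ctl lim] q assms(13) by blast+
      show "proj k q = proj k q'" using const[OF q(1,3)] .
    qed (use q z int_i cont assms(8,9) in blast)+
    moreover have "\<theta> (proj i q) - \<theta> (proj i q') = c * (proj i q - proj i q')"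
      using aff int_i unfolding affine_with_slope_def by (auto simp: algebra_simps)
    moreover have "proj_sign i * (proj i q - proj i q') + proj_sign j * (z - z') = 0"
      using proj_signed_sum_zero[OF ijk, of q] proj_signed_sum_zero[OF ijk, of q'] const[OF q(1,3)] q
      by (simp add: algebra_simps)
    ultimately have "proj_sign j * (\<theta> z - \<theta> z') = proj_sign j * (c * (z - z'))"
      unfolding q(2,4) by algebra
    thus ?thesis by (simp add: proj_sign_def split: if_splits)
  qed simp
  show "affine_with_slope \<theta> c (interior (proj j ` E))"
  proof (cases "interior (proj j ` E) = {}")
    case False
    then obtain z0 where z0: "z0 \<in> interior (proj j ` E)" by blast
    have "\<forall>z\<in>interior (proj j ` E). \<theta> z = c * z + (\<theta> z0 - c * z0)"
      using diff[OF _ z0] by (auto simp: algebra_simps)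
    thus ?thesis unfolding affine_with_slope_def by blast
  qed (simp add: affine_with_slope_def)
qed

end
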